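(* Let $p$ be a prime with $p\equiv 1\pmod 3$, let $q$ be a prime with $q\equiv 1\pmod 4$ such that $p$ is a quadratic residue modulo $q$. Then for the extended quadratic residue codes over $\mathcal{R}$ defined below, $\overline{Q_i}^\perp=\overline{Q_{i+4}}$ for $i=1,2,3,4$ and $\overline{Q_i}^\perp=\overline{Q_{i+3}}$ for $i=9,10,11$.
   Context: $\mathcal{R}=\mathbb{F}_p+u\mathbb{F}_p+u^2\mathbb{F}_p+u^3\mathbb{F}_p$ with $u^4=u$; $\mathcal{R}_q=\mathcal{R}[x]/\langle x^q-1\rangle$, codes identified with ideals, $\langle\cdot\rangle$ the ideal generated; duals with respect to the Euclidean inner product. $\xi\in\mathbb{F}_p$ is a primitive cube root of unity; $\eta_1=1-u^3$, $\eta_2=3^{-1}(u+u^2+u^3)$, $\eta_3=3^{-1}(\xi u+\xi^2u^2+u^3)$, $\eta_4=3^{-1}(\xi^2u+\xi u^2+u^3)$. With $Q_q,N_q$ the quadratic residues/non-residues mod $q$, $j_1=\sum_{i\in Q_q}x^i$, $j_2=\sum_{i\in N_q}x^i$, $\alpha$ a primitive $q$-th root of unity over $\mathbb{F}_p$, $\chi$ the Legendre symbol mod $q$, $\theta=\sum_{i=1}^{q-1}\chi(i)\alpha^i\in\mathbb{F}_p$: $\tilde e_1=\frac12(1-\frac1q)-\frac12(\frac1q+\frac1\theta)j_1-\frac12(\frac1q-\frac1\theta)j_2$, $\tilde e_2=\frac12(1-\frac1q)-\frac12(\frac1q+\frac1\theta)j_2-\frac12(\frac1q-\frac1\theta)j_1$.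 For $i=1,2,3,4$: $S_i=\langle(1-\eta_i)\tilde e_1+\eta_i\tilde e_2\rangle$, $S_{i+4}=\langle\eta_i\tilde e_1+(1-\eta_i)\tilde e_2\rangle$; for $k=9,10,11$ with $(i,j)=(1,2),(1,3),(1,4)$: $S_k=\langle(\eta_i+\eta_j)\tilde e_1+(1-\eta_i-\eta_j)\tilde e_2\rangle$, $S_{k+3}=\langle(\eta_i+\eta_j)\tilde e_2+(1-\eta_i-\eta_j)\tilde e_1\rangle$. Let $r_i=1$ for $i\in\{1,2,3,4,9,10,11\}$ and $r_i=-q$ for $i\in\{5,6,7,8,12,13,14\}$. Coordinates of $\mathcal{R}^{q+1}$ are indexed by $\infty,0,1,\dots,q-1$; $\overline{Q_i}$ is the $\mathcal{R}$-submodule of $\mathcal{R}^{q+1}$ generated by the vectors $(0,c_0,\dots,c_{q-1})$, $(c_0,\dots,c_{q-1})\in S_i$, together with $(r_i,1,\dots,1)$. *)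

theory Defs
  imports
    "HOL-Number_Theory.Residues"
    "HOL-Algebra.QuotRing"
    "HOL-Algebra.Algebraic_Closure_Type"
    "Berlekamp_Zassenhaus.Finite_Field"
    "Jordan_Normal_Form.VS_Connect"
begin

section \<open>The coefficient ring\<close>

text \<open>
  The ring \<open>R = F + u F + u\<^sup>2 F + u\<^sup>3 F\<close> with \<open>u\<^sup>4 = u\<close> is the quotient \<open>F[u] / (u\<^sup>4 - u)\<close>.
  It is made a type, so that polynomials and vectors over it are available.
\<close>

definition u_modulus :: "'a::comm_ring_1 poly" where
  "u_modulus = Polynomial.monom 1 4 - Polynomial.monom 1 1"

quotient_type (overloaded) 'a u_ring =
  "'a::comm_ring_1 poly" / "\<lambda>f g. u_modulus dvd (f - g)"
proof (rule equivpI)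
  show "reflp (\<lambda>f g::'a poly. u_modulus dvd (f - g))"
    by (rule reflpI) simp
  show "symp (\<lambda>f g::'a poly. u_modulus dvd (f - g))"
    by (rule sympI) (metis dvd_minus_iff minus_diff_eq)
  show "transp (\<lambda>f g::'a poly. u_modulus dvd (f - g))"
  proof (rule transpI)
    fix f g h :: "'a poly"
    assume "u_modulus dvd (f - g)" "u_modulus dvd (g - h)"
    from dvd_add[OF this] show "u_modulus dvd (f - h)" by simp
  qed
qed

instantiation u_ring :: (comm_ring_1) comm_ring_1
begin

lift_definition zero_u_ring :: "'a u_ring" is 0 .
lift_definition one_u_ring :: "'a u_ring" is 1 .
lift_definition plus_u_ring :: "'a u_ring \<Rightarrow> 'a u_ring \<Rightarrow> 'a u_ring" is "(+)"
  by (metis add_diff_add dvd_add)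
lift_definition uminus_u_ring :: "'a u_ring \<Rightarrow> 'a u_ring" is uminus
  by (metis dvd_minus_iff minus_diff_minus)
lift_definition minus_u_ring :: "'a u_ring \<Rightarrow> 'a u_ring \<Rightarrow> 'a u_ring" is "(-)"
  by (metis diff_diff_eq2 diff_add_eq add_diff_eq diff_diff_eq dvd_diff add.commute)
lift_definition times_u_ring :: "'a u_ring \<Rightarrow> 'a u_ring \<Rightarrow> 'a u_ring" is "(*)"
proof -
  fix f f' g g' :: "'a poly"
  assume "u_modulus dvd (f - f')" "u_modulus dvd (g - g')"
  then have "u_modulus dvd ((f - f') * g + f' * (g - g'))"
    by (intro dvd_add dvd_mult dvd_mult2)
  then show "u_modulus dvd (f * g - f' * g')"
    by (simp add: algebra_simps)
qed

instance
proof
  show "(0::'a u_ring) \<noteq> 1"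
  proof (transfer, rule notI)
    assume "u_modulus dvd (0 - 1 :: 'a poly)"
    then obtain k :: "'a poly" where "0 - 1 = u_modulus * k" ..
    then have "poly (0 - 1) 0 = poly (u_modulus * k) 0" by simp
    then show False by (simp add: u_modulus_def poly_monom)
  qed
qed (transfer; simp add: algebra_simps)+

end

lift_definition u_const :: "'a::comm_ring_1 \<Rightarrow> 'a u_ring" is "\<lambda>c. [:c:]" .

lift_definition u_gen :: "'a::comm_ring_1 u_ring" is "[:0, 1:]" .

lemma u_gen_power4: "(u_gen :: 'a::comm_ring_1 u_ring) ^ 4 = u_gen"
proof -
  have "(u_gen :: 'a u_ring) * u_gen * u_gen * u_gen = u_gen"
    by transfer (simp add: u_modulus_def eval_nat_numeral monom_Suc monom_0)
  then show ?thesis by (simp add: eval_nat_numeral mult.assoc)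
qed


section \<open>Cyclic codes as ideals\<close>

definition cyc_modulus :: "nat \<Rightarrow> 'r::comm_ring_1 poly set" where
  "cyc_modulus n = PIdl\<^bsub>class_ring\<^esub> (Polynomial.monom 1 n - 1)"

definition cyc_ring :: "nat \<Rightarrow> 'r::comm_ring_1 poly set ring" where
  "cyc_ring n = class_ring Quot (cyc_modulus n)"

definition cyc_class :: "nat \<Rightarrow> 'r::comm_ring_1 poly \<Rightarrow> 'r poly set" where
  "cyc_class n f = cyc_modulus n +>\<^bsub>class_ring\<^esub> f"

definition cyc_ideal :: "nat \<Rightarrow> 'r::comm_ring_1 poly \<Rightarrow> 'r poly set set" where
  "cyc_ideal n f = Idl\<^bsub>cyc_ring n\<^esub> {cyc_class n f}"

text \<open>A word \<open>(c\<^sub>0, \<dots>, c\<^bsub>n-1\<^esub>)\<close> is identified with the class of \<open>c\<^sub>0 + \<dots> + c\<^bsub>n-1\<^esub> x\<^bsup>n-1\<^esup>\<close>.\<close>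

definition code_of_ideal :: "nat \<Rightarrow> 'r::comm_ring_1 poly set set \<Rightarrow> 'r vec set" where
  "code_of_ideal n I =
     {c \<in> carrier_vec n. cyc_class n (\<Sum>i<n. Polynomial.monom (c $ i) i) \<in> I}"

abbreviation euclidean_dual :: "nat \<Rightarrow> 'r::comm_ring_1 vec set \<Rightarrow> 'r vec set" where
  "euclidean_dual \<equiv> vec_module.orthogonal_complement"


section \<open>Quadratic residue codes\<close>

definition primitive_root_of_unity :: "nat \<Rightarrow> 'a::comm_ring_1 \<Rightarrow> bool" where
  "primitive_root_of_unity n z \<longleftrightarrow> n > 0 \<and> z ^ n = 1 \<and> (\<forall>k\<in>{1..<n}. z ^ k \<noteq> 1)"

definition quad_residues :: "nat \<Rightarrow> nat set" where
  "quad_residues q = {i \<in> {1..<q}. QuadRes (int q) (int i)}"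

definition quad_nonresidues :: "nat \<Rightarrow> nat set" where
  "quad_nonresidues q = {i \<in> {1..<q}. \<not> QuadRes (int q) (int i)}"

text \<open>
  The root of unity \<open>\<alpha>\<close> lives in the algebraic closure of the field; if the characteristic is a
  quadratic residue modulo \<open>q\<close>, the sum below lies in the image of the prime field, and
  \<^const>\<open>of_ac\<close> pulls it back.
\<close>

definition gauss_theta :: "nat \<Rightarrow> 'p::prime_card mod_ring alg_closure \<Rightarrow> 'p mod_ring" where
  "gauss_theta q \<alpha> = of_ac (\<Sum>i=1..q-1. of_int (Legendre (int i) (int q)) * \<alpha> ^ i)"

definition j1 :: "nat \<Rightarrow> 'p::prime_card mod_ring poly" where
  "j1 q = (\<Sum>i\<in>quad_residues q. Polynomial.monom 1 i)"

definition j2 :: "nat \<Rightarrow> 'p::prime_card mod_ring poly" where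
  "j2 q = (\<Sum>i\<in>quad_nonresidues q. Polynomial.monom 1 i)"

definition e1 :: "nat \<Rightarrow> 'p::prime_card mod_ring alg_closure \<Rightarrow> 'p mod_ring poly" where
  "e1 q \<alpha> = [:1/2 * (1 - 1 / of_nat q):]
     - Polynomial.smult (1/2 * (1 / of_nat q + 1 / gauss_theta q \<alpha>)) (j1 q)
     - Polynomial.smult (1/2 * (1 / of_nat q - 1 / gauss_theta q \<alpha>)) (j2 q)"

definition e2 :: "nat \<Rightarrow> 'p::prime_card mod_ring alg_closure \<Rightarrow> 'p mod_ring poly" where
  "e2 q \<alpha> = [:1/2 * (1 - 1 / of_nat q):]
     - Polynomial.smult (1/2 * (1 / of_nat q + 1 / gauss_theta q \<alpha>)) (j2 q)
     - Polynomial.smult (1/2 * (1 / of_nat q - 1 / gauss_theta q \<alpha>)) (j1 q)"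

text \<open>Meant for the indices 1 to 4.\<close>

definition eta :: "'p::prime_card mod_ring \<Rightarrow> nat \<Rightarrow> 'p mod_ring u_ring" where
  "eta \<xi> i =
     (if i = 1 then 1 - u_gen ^ 3
      else if i = 2 then u_const (inverse 3) * (u_gen + u_gen ^ 2 + u_gen ^ 3)
      else if i = 3 then u_const (inverse 3) *
        (u_const \<xi> * u_gen + u_const (\<xi> ^ 2) * u_gen ^ 2 + u_gen ^ 3)
      else u_const (inverse 3) *
        (u_const (\<xi> ^ 2) * u_gen + u_const \<xi> * u_gen ^ 2 + u_gen ^ 3))"

text \<open>
  Meant for the indices 1 to 14. The indices 9, 10, 11, and likewise 12, 13, 14, belong to the
  pairs \<open>(\<eta>\<^sub>1, \<eta>\<^sub>2)\<close>, \<open>(\<eta>\<^sub>1, \<eta>\<^sub>3)\<close>, \<open>(\<eta>\<^sub>1, \<eta>\<^sub>4)\<close>.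
\<close>

definition qr_generator ::
  "nat \<Rightarrow> 'p::prime_card mod_ring alg_closure \<Rightarrow> 'p mod_ring \<Rightarrow> nat \<Rightarrow> 'p mod_ring u_ring poly" where
  "qr_generator q \<alpha> \<xi> k =
     (let \<eta> = eta \<xi>; E1 = map_poly u_const (e1 q \<alpha>); E2 = map_poly u_const (e2 q \<alpha>) in
      if k \<in> {1..4} then
        Polynomial.smult (1 - \<eta> k) E1 + Polynomial.smult (\<eta> k) E2
      else if k \<in> {5..8} then
        Polynomial.smult (\<eta> (k - 4)) E1 + Polynomial.smult (1 - \<eta> (k - 4)) E2
      else if k \<in> {9..11} then
        Polynomial.smult (\<eta> 1 + \<eta> (k - 7)) E1 + Polynomial.smult (1 - \<eta> 1 - \<eta> (k - 7)) E2
      else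
        Polynomial.smult (\<eta> 1 + \<eta> (k - 10)) E2 + Polynomial.smult (1 - \<eta> 1 - \<eta> (k - 10)) E1)"

definition qr_ideal ::
  "nat \<Rightarrow> 'p::prime_card mod_ring alg_closure \<Rightarrow> 'p mod_ring \<Rightarrow> nat \<Rightarrow> 'p mod_ring u_ring poly set set" where
  "qr_ideal q \<alpha> \<xi> k = cyc_ideal q (qr_generator q \<alpha> \<xi> k)"

definition border :: "nat \<Rightarrow> nat \<Rightarrow> 'r::comm_ring_1" where
  "border q k = (if k \<in> {1, 2, 3, 4, 9, 10, 11} then 1 else - of_nat q)"

text \<open>
  Position 0 of a vector of length \<open>q + 1\<close> is the coordinate \<open>\<infinity>\<close>, and position \<open>i + 1\<close> is the
  coordinate \<open>i\<close>.
\<close>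

definition extended_qr_code ::
  "nat \<Rightarrow> 'p::prime_card mod_ring alg_closure \<Rightarrow> 'p mod_ring \<Rightarrow> nat \<Rightarrow> 'p mod_ring u_ring vec set" where
  "extended_qr_code q \<alpha> \<xi> k =
     LinearCombinations.module.span class_ring (module_vec TYPE('p mod_ring u_ring) (q + 1))
       (vCons 0 ` code_of_ideal q (qr_ideal q \<alpha> \<xi> k) \<union> {vCons (border q k) (vec q (\<lambda>_. 1))})"

end

theory Submission
  imports Defs "HOL-Number_Theory.Quadratic_Reciprocity"
begin

text \<open>
  Write \<open>h = 1 + x + \<dots> + x\<^bsup>q-1\<^esup>\<close> and \<open>J = \<Sum>\<^sub>i \<chi>(i) x\<^sup>i\<close>. Modulo \<open>x\<^sup>q - 1\<close> one has \<open>J\<^sup>2 = q - h\<close>, and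
  \<open>\<theta> = J(\<alpha>)\<close> gives \<open>\<theta>\<^sup>2 = q\<close>. Hence the generators \<open>1/2 (1 - h/q \<mp> J/\<theta>)\<close> multiply to zero, add up to
  \<open>1 - h/q\<close>, and are invariant under \<open>x \<mapsto> x\<^bsup>-1\<^esup>\<close> because \<open>\<chi>(-1) = 1\<close>. The generators of the fourteen
  codes are \<open>f\<^sub>\<eta> = (1 - \<eta>) e\<^sub>1 + \<eta> e\<^sub>2\<close> for idempotents \<open>\<eta>\<close>, and \<open>f\<^sub>\<eta>\<close>, \<open>f\<^bsub>1-\<eta>\<^esub>\<close> inherit
  these three properties. If \<open>v\<close> is orthogonal to \<open>\<langle>f\<^sub>\<eta>\<rangle>\<close>, that is \<open>v f\<^sub>\<eta> = 0\<close>, then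
  \<open>v = v f\<^bsub>1-\<eta>\<^esub> + v(1) h/q\<close>, so the dual of \<open>\<langle>f\<^sub>\<eta>\<rangle>\<close> is \<open>\<langle>f\<^bsub>1-\<eta>\<^esub>\<rangle>\<close> enlarged by the
  all-one word, and the border entries fix the coordinate at \<open>\<infinity>\<close>.
\<close>

section \<open>The quadratic character\<close>

lemma Legendre_mod: "Legendre (a mod p) p = Legendre a p"
  by (simp add: Legendre_def QuadRes_def cong_def)

lemma Legendre_values: "Legendre a p \<in> {-1, 0, 1}"
  by (simp add: Legendre_def)

text \<open>By Euler's criterion both sides are congruent modulo q. Both lie in {-1, 0, 1}, so they
  differ by at most 2 < q and are equal.\<close>

lemma Legendre_mult:
  fixes q :: nat
  assumes "prime q" and "2 < q"
  shows "Legendre (a * b) q = Legendre a q * Legendre b q"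
proof -
  have "[Legendre (a * b) q = (a * b) ^ ((q - 1) div 2)] (mod q)"
    using assms by (rule euler_criterion)
  moreover have "[Legendre a q * Legendre b q = a ^ ((q - 1) div 2) * b ^ ((q - 1) div 2)] (mod q)"
    using assms by (intro cong_mult euler_criterion)
  ultimately have "[Legendre (a * b) q = Legendre a q * Legendre b q] (mod q)"
    by (metis cong_sym cong_trans power_mult_distrib)
  then have "int q dvd Legendre (a * b) q - Legendre a q * Legendre b q"
    by (simp add: cong_iff_dvd_diff)
  moreover have "\<bar>Legendre (a * b) q - Legendre a q * Legendre b q\<bar> < int q"
    using Legendre_values[of "a * b" q] Legendre_values[of a q] Legendre_values[of b q] assms(2)
    by auto
  ultimately show ?thesis
    by (metis dvd_imp_le_int right_minus_eq abs_of_nat not_le)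
qed

lemma Legendre_square:
  fixes q :: nat
  assumes "coprime a (int q)"  and "1 < q"
  shows "Legendre a q * Legendre a q = 1"
proof -
  have "\<not> [a = 0] (mod q)"
    using assms by (auto simp: cong_0_iff coprime_absorb_right)
  then show ?thesis by (simp add: Legendre_def)
qed

text \<open>As a is a unit modulo n, i -> a i + k permutes the residues modulo n, and F depends only
  on the residue.\<close>

lemma sum_affine_mod:
  fixes F :: "int \<Rightarrow> 'b::comm_monoid_add" and n :: nat
  assumes "n > 0" and per: "\<And>x. F (x mod int n) = F x" and cop: "coprime a (int n)"
  shows "(\<Sum>i\<in>{0..<int n}. F (a * i + k)) = (\<Sum>i\<in>{0..<int n}. F i)"
proof -
  have inj: "inj_on (\<lambda>i. (a * i + k) mod int n) {0..<int n}"
  proof (rule inj_onI)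
    fix x y assume xy: "x \<in> {0..<int n}" "y \<in> {0..<int n}"
      and "(a * x + k) mod int n = (a * y + k) mod int n"
    then have "[a * x = a * y] (mod int n)"
      by (metis cong_add_rcancel cong_def)
    then have "[x = y] (mod int n)"
      using cop by (simp add: cong_mult_lcancel)
    then show "x = y" using xy by (simp add: cong_def)
  qed
  have "bij_betw (\<lambda>i. (a * i + k) mod int n) {0..<int n} {0..<int n}"
    unfolding bij_betw_def
    using inj assms(1) by (intro conjI endo_inj_surj inj) auto
  from sum.reindex_bij_betw[OF this, of F] show ?thesis
    by (simp add: per)
qed

text \<open>If every residue were a square, squaring would be onto, hence injective, on the q
  residues. But 1 and q - 1 have the same square and are distinct since q > 2.\<close>

lemma ex_quad_nonresidue:
  fixes q :: nat
  assumes "prime q" and "2 < q"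
  shows "\<exists>a. Legendre a q = -1"
proof (rule ccontr)
  assume no: "\<not> ?thesis"
  let ?f = "\<lambda>y. y\<^sup>2 mod int q"
  have "{0..<int q} \<subseteq> ?f ` {0..<int q}"
  proof
    fix a assume a: "a \<in> {0..<int q}"
    have "\<exists>y. [y\<^sup>2 = a] (mod q)"
    proof (cases "[a = 0] (mod q)")
      case True
      then show ?thesis by (intro exI[of _ 0]) (simp add: cong_sym)
    next
      case False
      then show ?thesis using no by (metis Legendre_def QuadRes_def)
    qed
    then obtain y where "[y\<^sup>2 = a] (mod q)" ..
    then have "?f (y mod q) = a" using a by (simp add: cong_def power_mod)
    moreover have "y mod q \<in> {0..<int q}" using assms by simp
    ultimately show "a \<in> ?f ` {0..<int q}" by blast
  qed
  then have "inj_on ?f {0..<int q}"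
    by (intro finite_surj_inj) auto
  moreover have "?f 1 = ?f (int q - 1)"
  proof -
    have "int q dvd (int q - 1)\<^sup>2 - 1\<^sup>2"
      by (simp add: power2_eq_square algebra_simps)
    then show ?thesis by (simp add: mod_eq_dvd_iff dvd_diff_commute)
  qed
  ultimately have "1 = int q - 1"
    using assms by (elim inj_onD) auto
  then show False using assms by simp
qed

text \<open>Scaling the argument by a nonresidue permutes the residues and multiplies every term by
  -1, so the sum equals its own negative.\<close>

lemma sum_Legendre:
  fixes q :: nat
  assumes "prime q" and "2 < q"
  shows "(\<Sum>i\<in>{0..<int q}. Legendre i q) = 0"
proof -
  obtain a where a: "Legendre a q = -1" using ex_quad_nonresidue[OF assms] ..
  then have "\<not> int q dvd a" by (auto simp: Legendre_def cong_0_iff)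
  then have cop: "coprime a (int q)"
    using assms(1) prime_imp_coprime[of "int q" a] by (simp add: coprime_commute)
  have "(\<Sum>i\<in>{0..<int q}. Legendre i q) = (\<Sum>i\<in>{0..<int q}. Legendre (a * i + 0) q)"
    using assms cop by (intro sum_affine_mod[symmetric]) (auto simp: Legendre_mod)
  also have "\<dots> = - (\<Sum>i\<in>{0..<int q}. Legendre i q)"
    using assms by (simp add: Legendre_mult a sum_negf)
  finally show ?thesis by simp
qed

lemma cong_1_mod_4_imp_gt_2:
  assumes "prime (q :: nat)" and "[q = 1] (mod 4)"
  shows "2 < q"
  using assms prime_ge_2_nat[of q] by (cases "q = 2") (auto simp: cong_def)

text \<open>The exponent (q - 1)/2 in Euler's criterion is even, and 1 is congruent to neither 0 nor
  -1 modulo q > 2.\<close>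

lemma Legendre_minus_one:
  fixes q :: nat
  assumes "prime q" and "[q = 1] (mod 4)"
  shows "Legendre (-1) q = 1"
proof -
  have q2: "2 < q" using assms by (intro cong_1_mod_4_imp_gt_2)
  have "even ((q - 1) div 2)"
    using assms(2) unfolding cong_def by presburger
  with euler_criterion[OF assms(1) q2, of "-1"] have "[Legendre (-1) q = 1] (mod q)"
    by simp
  then have "int q dvd Legendre (-1) q - 1" by (simp add: cong_iff_dvd_diff)
  then show ?thesis
    using Legendre_values[of "-1" q] q2 zdvd_imp_le[of "int q" 2] by auto
qed

text \<open>
  For \<open>k \<noteq> 0\<close> the sum does not depend on \<open>k\<close> (substitute \<open>i \<mapsto> k i\<close>), and the sum over all \<open>k\<close>
  is the square of the vanishing sum of the character.
\<close>

lemma sum_Legendre_convolution: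
  fixes q :: nat
  assumes "prime q" and "[q = 1] (mod 4)" and k: "k \<in> {0..<int q}"
  shows "(\<Sum>i\<in>{0..<int q}. Legendre i q * Legendre (k - i) q) = (if k = 0 then int q else 0) - 1"
proof -
  have q2: "2 < q" using assms by (intro cong_1_mod_4_imp_gt_2)
  note mult = Legendre_mult[OF assms(1) q2]
  define N where "N k = (\<Sum>i\<in>{0..<int q}. Legendre i q * Legendre (k - i) q)" for k
  have cop: "coprime a (int q)" if "a \<in> {1..<int q}" for a
    using that assms(1)
      prime_imp_coprime[of "int q" a] zdvd_imp_le[of "int q" a]
    by (force simp: coprime_commute)
  have split0: "{0..<int q} = insert 0 {1..<int q}" using q2 by auto
  have N0: "N 0 = int q - 1"
  proof -
    have "N 0 = (\<Sum>i\<in>{0..<int q}. Legendre i q * (Legendre (-1) q * Legendre i q))"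
      unfolding N_def by (simp flip: mult)
    also have "\<dots> = (\<Sum>i\<in>{0..<int q}. Legendre i q * Legendre i q)"
      by (simp add: Legendre_minus_one[OF assms(1,2)])
    also have "\<dots> = (\<Sum>i\<in>{1..<int q}. Legendre i q * Legendre i q)"
      unfolding split0 by (simp add: Legendre_def)
    also have "\<dots> = (\<Sum>i\<in>{1..<int q}. 1)"
      using q2 by (intro sum.cong refl Legendre_square cop) auto
    finally show ?thesis using q2 by simp
  qed
  have scale: "N a = N 1" if a: "a \<in> {1..<int q}" for a
  proof -
    have per: "Legendre (x mod int q) q * Legendre (a - x mod int q) q
        = Legendre x q * Legendre (a - x) q" for x
      by (metis Legendre_mod mod_diff_right_eq)
    have "N a = (\<Sum>i\<in>{0..<int q}. Legendre (a * i + 0) q * Legendre (a - (a * i + 0)) q)"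
      unfolding N_def
      using sum_affine_mod[of q "\<lambda>i. Legendre i q * Legendre (a - i) q" a 0] per cop[OF a] q2
      by simp
    \<comment> \<open>Since a - a i = a (1 - i), a factor \<chi>(a)^2 = 1 comes out.\<close>
    also have "\<dots> = (\<Sum>i\<in>{0..<int q}. (Legendre a q * Legendre a q) * (Legendre i q * Legendre (1 - i) q))"
    proof (intro sum.cong refl)
      fix i
      have "Legendre (a - (a * i + 0)) q = Legendre a q * Legendre (1 - i) q"
        by (simp flip: mult add: algebra_simps)
      then show "Legendre (a * i + 0) q * Legendre (a - (a * i + 0)) q
        = (Legendre a q * Legendre a q) * (Legendre i q * Legendre (1 - i) q)"
        by (simp add: mult)
    qed
    also have "\<dots> = N 1"
      using Legendre_square[OF cop[OF a]] q2 by (simp add: N_def)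
    finally show ?thesis .
  qed
  have "(\<Sum>k\<in>{0..<int q}. N k)
      = (\<Sum>i\<in>{0..<int q}. Legendre i q * (\<Sum>k\<in>{0..<int q}. Legendre (1 * k + (- i)) q))"
    unfolding N_def by (subst sum.swap) (simp add: sum_distrib_left)
  also have "\<dots> = (\<Sum>i\<in>{0..<int q}. Legendre i q * (\<Sum>k\<in>{0..<int q}. Legendre k q))"
    using q2 by (subst sum_affine_mod) (auto simp: Legendre_mod)
  also have "\<dots> = 0"
    by (simp add: sum_Legendre[OF assms(1) q2])
  \<comment> \<open>The total 0 is N 0 + (q - 1) N 1 with N 0 = q - 1, which forces N 1 =
    -1.\<close>
  finally have "0 = N 0 + (\<Sum>k\<in>{1..<int q}. N k)"
    unfolding split0 by simp
  also have "(\<Sum>k\<in>{1..<int q}. N k) = (\<Sum>k\<in>{1..<int q}. N 1)"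
    by (intro sum.cong refl scale)
  also have "N 0 + \<dots> = (int q - 1) * (1 + N 1)"
    using q2 by (simp add: N0 algebra_simps)
  finally have "N 1 = -1" using q2 by simp
  then show ?thesis
    using N0 scale[of k] k unfolding N_def[symmetric] by auto
qed

section \<open>Cyclic codes\<close>

text \<open>Applied to \<open>vec_index c\<close>, this is the polynomial that
  \<open>code_of_ideal\<close> attaches to the word c. Values from n on are ignored.\<close>

definition word_poly :: "nat \<Rightarrow> (nat \<Rightarrow> 'r::comm_ring_1) \<Rightarrow> 'r poly" where
  "word_poly n c = (\<Sum>i<n. Polynomial.monom (c i) i)"

text \<open>The coefficient of x^k in a product modulo x^n - 1. The summand n keeps k - i from being
  truncated to 0 before reduction.\<close>

definition cyc_conv :: "nat \<Rightarrow> (nat \<Rightarrow> 'r::comm_ring_1) \<Rightarrow> (nat \<Rightarrow> 'r) \<Rightarrow> nat \<Rightarrow> 'r" where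
  "cyc_conv n c d k = (\<Sum>i<n. c i * d ((k + n - i) mod n))"

text \<open>Invariance of the word polynomial under x -> x^(-1) modulo x^n - 1. The
  \<open>mod n\<close> sends the index n, which arises from i = 0, back to 0.\<close>

definition reversible :: "nat \<Rightarrow> (nat \<Rightarrow> 'r) \<Rightarrow> bool" where
  "reversible n d \<longleftrightarrow> (\<forall>i<n. d ((n - i) mod n) = d i)"

abbreviation cyc_poly :: "nat \<Rightarrow> 'r::comm_ring_1 poly" where
  "cyc_poly n \<equiv> Polynomial.monom 1 n - 1"

section \<open>Words and polynomials modulo x^n - 1\<close>

lemma word_poly_cong: "(\<And>i. i < n \<Longrightarrow> c i = d i) \<Longrightarrow> word_poly n c = word_poly n d"
  unfolding word_poly_def by (intro sum.cong) auto

lemma word_poly_add: "word_poly n (\<lambda>i. c i + d i) = word_poly n c + word_poly n d"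
  by (simp add: word_poly_def sum.distrib flip: add_monom)

lemma word_poly_diff: "word_poly n (\<lambda>i. c i - d i) = word_poly n c - word_poly n d"
  by (simp add: word_poly_def sum_subtractf flip: diff_monom)

lemma word_poly_smult: "word_poly n (\<lambda>i. a * c i) = Polynomial.smult a (word_poly n c)"
  by (simp add: word_poly_def smult_sum2 smult_monom)

lemma word_poly_delta: "n > 0 \<Longrightarrow> word_poly n (\<lambda>i. if i = 0 then 1 else 0) = 1"
  unfolding word_poly_def
  by (subst sum.remove[of _ 0]) (auto intro!: sum.neutral)

lemma poly_word_poly_1: "poly (word_poly n c) 1 = (\<Sum>i<n. c i)"
  by (simp add: word_poly_def poly_sum poly_monom)

lemma coeff_word_poly: "poly.coeff (word_poly n c) i = (if i < n then c i else 0)"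
  by (simp add: word_poly_def coeff_sum)

text \<open>x^i is x^(i mod n) times a power of x^n, and y - 1 divides every y^k - 1.\<close>

lemma cyc_poly_dvd_monom_diff:
  "cyc_poly n dvd Polynomial.monom a i - Polynomial.monom (a :: 'r::comm_ring_1) (i mod n)"
proof -
  have "Polynomial.monom a i - Polynomial.monom a (i mod n)
      = Polynomial.monom a (i mod n) * (Polynomial.monom 1 n ^ (i div n) - 1)"
    by (simp add: monom_power mult_monom algebra_simps)
  moreover have "cyc_poly n dvd Polynomial.monom 1 n ^ (i div n) - (1 :: 'r poly)"
    by (metis dvd_triv_left power_diff_1_eq)
  ultimately show ?thesis by simp
qed

text \<open>Since x^n - 1 is monic of degree n > 0, its nonzero multiples have degree at least n
  even when the coefficients have zero divisors. A word polynomial has degree below n.\<close>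

lemma word_poly_dvd_iff:
  fixes c :: "nat \<Rightarrow> 'r::comm_ring_1"
  assumes "n > 0"
  shows "cyc_poly n dvd word_poly n c \<longleftrightarrow> (\<forall>i<n. c i = 0)"
proof
  assume "cyc_poly n dvd word_poly n c"
  then obtain k where k: "word_poly n c = cyc_poly n * k" ..
  have "k = 0"
  proof (rule ccontr)
    assume "k \<noteq> 0"
    have "poly.coeff (cyc_poly n * k) (n + Polynomial.degree k)
        = poly.coeff k (Polynomial.degree k)"
      using assms by (simp add: left_diff_distrib coeff_monom_mult coeff_eq_0)
    moreover have "poly.coeff (cyc_poly n * k) (n + Polynomial.degree k) = 0"
      unfolding k[symmetric] by (simp add: coeff_word_poly)
    ultimately show False using \<open>k \<noteq> 0\<close> by simp
  qed
  then show "\<forall>i<n. c i = 0"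
    using k by (metis coeff_word_poly coeff_0 mult_zero_right)
next
  assume "\<forall>i<n. c i = 0"
  then have "word_poly n c = 0" by (simp add: word_poly_def)
  then show "cyc_poly n dvd word_poly n c" by simp
qed

text \<open>Folding: position k collects the coefficients at all exponents congruent to k modulo
  n.\<close>

lemma ex_word_poly_cong:
  fixes f :: "'r::comm_ring_1 poly"
  assumes "n > 0"
  shows "\<exists>c. cyc_poly n dvd f - word_poly n c"
proof
  let ?d = "Polynomial.degree f"
  let ?c = "\<lambda>k. \<Sum>i\<le>?d. if i mod n = k then poly.coeff f i else 0"
  have "word_poly n ?c = (\<Sum>i\<le>?d. \<Sum>k<n. Polynomial.monom (if i mod n = k then poly.coeff f i else 0) k)"
    unfolding word_poly_def by (subst sum.swap) (simp add: monom_sum)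
  also have "\<dots> = (\<Sum>i\<le>?d. \<Sum>k<n. if i mod n = k then Polynomial.monom (poly.coeff f i) k else 0)"
    by (intro sum.cong) auto
  also have "\<dots> = (\<Sum>i\<le>?d. Polynomial.monom (poly.coeff f i) (i mod n))"
    using assms by (intro sum.cong) auto
  finally have "f - word_poly n ?c
      = (\<Sum>i\<le>?d. Polynomial.monom (poly.coeff f i) i - Polynomial.monom (poly.coeff f i) (i mod n))"
    by (simp add: sum_subtractf poly_as_sum_of_monoms)
  then show "cyc_poly n dvd f - word_poly n ?c"
    by (simp add: dvd_sum cyc_poly_dvd_monom_diff)
qed

lemma mod_add_sub_cancel:
  fixes i j n :: nat
  assumes "i < n"
  shows "(i + (j + n - i) mod n) mod n = j mod n"
  using assms by (simp add: mod_add_right_eq)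

lemma bij_betw_sub_mod:
  fixes i n :: nat
  assumes "i < n"
  shows "bij_betw (\<lambda>k. (k + n - i) mod n) {..<n} {..<n}"
proof -
  have "inj_on (\<lambda>k. (k + n - i) mod n) {..<n}"
    by (rule inj_onI) (metis lessThan_iff mod_less mod_add_sub_cancel[OF assms])
  then show ?thesis
    unfolding bij_betw_def using assms by (intro conjI endo_inj_surj) auto
qed

text \<open>For fixed i, the substitution j = k - i modulo n turns the convolution into the ordinary
  product with every exponent i + j reduced modulo n. Reduction changes a monomial by a multiple of
  x^n - 1.\<close>

lemma word_poly_mult:
  fixes c d :: "nat \<Rightarrow> 'r::comm_ring_1"
  shows "cyc_poly n dvd word_poly n c * word_poly n d - word_poly n (cyc_conv n c d)"
proof -
  have conv: "word_poly n (cyc_conv n c d) = (\<Sum>i<n. \<Sum>j<n. Polynomial.monom (c i * d j) ((i + j) mod n))"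
  proof -
    have "word_poly n (cyc_conv n c d)
        = (\<Sum>i<n. \<Sum>k<n. Polynomial.monom (c i * d ((k + n - i) mod n)) k)"
      unfolding word_poly_def cyc_conv_def by (subst sum.swap) (simp add: monom_sum)
    also have "\<dots> = (\<Sum>i<n. \<Sum>k<n. Polynomial.monom (c i * d ((k + n - i) mod n))
                        ((i + (k + n - i) mod n) mod n))"
      by (intro sum.cong refl) (simp only: mod_add_sub_cancel lessThan_iff mod_less)
    also have "\<dots> = (\<Sum>i<n. \<Sum>j<n. Polynomial.monom (c i * d j) ((i + j) mod n))"
      by (intro sum.cong refl
          sum.reindex_bij_betw[where g = "\<lambda>j. Polynomial.monom (c _ * d j) ((_ + j) mod n)"]
          bij_betw_sub_mod) simp
    finally show ?thesis .
  qed
  have "word_poly n c * word_poly n d = (\<Sum>i<n. \<Sum>j<n. Polynomial.monom (c i * d j) (i + j))"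
    unfolding word_poly_def by (simp add: sum_product mult_monom)
  then have "word_poly n c * word_poly n d - word_poly n (cyc_conv n c d)
      = (\<Sum>i<n. \<Sum>j<n. Polynomial.monom (c i * d j) (i + j)
                          - Polynomial.monom (c i * d j) ((i + j) mod n))"
    unfolding conv by (simp add: sum_subtractf)
  then show ?thesis
    by (simp add: dvd_sum cyc_poly_dvd_monom_diff)
qed

lemma dvd_word_poly_mult_iff:
  assumes "n > 0"
  shows "cyc_poly n dvd word_poly n c * word_poly n d \<longleftrightarrow> (\<forall>k<n. cyc_conv n c d k = 0)"
  using word_poly_mult[of n c d] word_poly_dvd_iff[OF assms, of "cyc_conv n c d"]
  by (metis dvd_add_right_iff diff_add_cancel dvd_diff_right_iff)

text \<open>The matrix with entries d(k - i) is symmetric, so convolution with d is self-adjoint for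
  the Euclidean product.\<close>

lemma sum_mult_cyc_conv:
  assumes sym: "reversible n d"
  shows "(\<Sum>k<n. v k * cyc_conv n c d k) = (\<Sum>i<n. c i * cyc_conv n v d i)"
proof -
  have swap: "d ((k + n - i) mod n) = d ((i + n - k) mod n)" if "i < n" "k < n" for i k
  proof -
    have "d ((n - (i + n - k) mod n) mod n) = d ((i + n - k) mod n)"
      using sym that by (simp add: reversible_def)
    moreover have "(n - (i + n - k) mod n) mod n = (k + n - i) mod n"
    proof (cases "k \<le> i")
      case True
      then have "(i + n - k) mod n = i - k" using that by (simp add: mod_if)
      then show ?thesis using True that by (simp add: add.commute)
    next
      case False
      then have "i + n - k < n" and "(k + n - i) mod n = k - i" using that by (simp_all add: mod_if)
      then show ?thesis using False that by simp
    qed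
    ultimately show ?thesis by simp
  qed
  show ?thesis
    unfolding cyc_conv_def sum_distrib_left
    by (subst sum.swap) (auto intro!: sum.cong simp: swap mult_ac)
qed

text \<open>With h the all-one polynomial, (x - 1) h = x^n - 1, and x - 1 divides g - g(1). Hence h
  kills g - g(1) modulo x^n - 1.\<close>

lemma ones_mult:
  "cyc_poly n dvd word_poly n (\<lambda>_. 1) * g - Polynomial.smult (poly g 1) (word_poly n (\<lambda>_. 1))"
proof -
  have "[:-1, 1:] * word_poly n (\<lambda>_. 1 :: 'a) = cyc_poly n"
  proof -
    have x: "[:-1, 1 :: 'a:] = Polynomial.monom 1 1 - 1" by (simp add: monom_Suc monom_0 one_pCons)
    have "word_poly n (\<lambda>_. 1 :: 'a) = (\<Sum>i<n. Polynomial.monom 1 1 ^ i)"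
      by (simp add: word_poly_def monom_power)
    then have "[:-1, 1:] * word_poly n (\<lambda>_. 1 :: 'a) = (Polynomial.monom 1 1 - 1) * (\<Sum>i<n. Polynomial.monom (1 :: 'a) 1 ^ i)"
      by (simp only: x)
    also have "\<dots> = Polynomial.monom 1 1 ^ n - 1" by (rule power_diff_1_eq[symmetric])
    also have "\<dots> = cyc_poly n" by (simp add: monom_power)
    finally show ?thesis .
  qed
  moreover have "[:-1, 1:] dvd g - [:poly g 1:]"
    using poly_eq_0_iff_dvd[of "g - [:poly g 1:]" 1] by simp
  ultimately have "cyc_poly n dvd (g - [:poly g 1:]) * word_poly n (\<lambda>_. 1)"
    by (metis dvd_refl mult_dvd_mono)
  then show ?thesis by (simp add: algebra_simps)
qed

section \<open>Ideals of the quotient ring as sets of words\<close>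

lemma cyc_class_eq_iff:
  "cyc_class n f = cyc_class n g \<longleftrightarrow> cyc_poly n dvd f - g"
proof -
  have cls: "h \<in> cyc_class n f \<longleftrightarrow> cyc_poly n dvd h - f" for f h :: "'a poly"
  proof -
    have "h \<in> cyc_class n f \<longleftrightarrow> (\<exists>k. h = k * cyc_poly n + f)"
      by (auto simp: cyc_class_def cyc_modulus_def a_r_coset_def r_coset_def cgenideal_def)
    also have "\<dots> \<longleftrightarrow> (\<exists>k. h - f = cyc_poly n * k)"
      by (simp add: diff_eq_eq mult.commute)
    finally show ?thesis by (simp add: dvd_def)
  qed
  show ?thesis
  proof
    assume "cyc_class n f = cyc_class n g"
    then have "f \<in> cyc_class n g" using cls[of f f] by simp
    then show "cyc_poly n dvd f - g" by (simp add: cls)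
  next
    assume d: "cyc_poly n dvd f - g"
    have "cyc_poly n dvd h - f \<longleftrightarrow> cyc_poly n dvd h - g" for h
      using dvd_add_right_iff[OF d, of "h - f"] by simp
    then show "cyc_class n f = cyc_class n g" by (auto simp: cls)
  qed
qed

text \<open>The quotient ring is commutative, so the ideal generated by one class consists of its
  multiples, and each multiplier is the class of a polynomial.\<close>

lemma cyc_class_in_cyc_ideal_iff:
  fixes f c :: "'r::comm_ring_1 poly"
  shows "cyc_class n c \<in> cyc_ideal n f \<longleftrightarrow> (\<exists>g. cyc_poly n dvd c - g * f)"
proof -
  let ?R = "class_ring :: 'r poly ring"
  have I: "ideal (cyc_modulus n) ?R"
    unfolding cyc_modulus_def by (rule cring.cgenideal_ideal[OF class_cring.is_cring]) simp
  then interpret Q: cring "cyc_ring n :: 'r poly set ring"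
    unfolding cyc_ring_def by (rule ideal.quotient_is_cring[OF _ class_cring.is_cring])
  have mult: "cyc_class n g \<otimes>\<^bsub>cyc_ring n\<^esub> cyc_class n f = cyc_class n (g * f)" for g :: "'r poly"
    using ideal.rcoset_mult_add[OF I, of g f] by (simp add: cyc_ring_def FactRing_def cyc_class_def)
  have carr: "carrier (cyc_ring n) = range (cyc_class n :: 'r poly \<Rightarrow> _)"
    by (auto simp: cyc_ring_def FactRing_def A_RCOSETS_def RCOSETS_def a_r_coset_def cyc_class_def)
  have "cyc_ideal n f = PIdl\<^bsub>cyc_ring n\<^esub> cyc_class n f"
    unfolding cyc_ideal_def by (rule Q.cgenideal_eq_genideal[symmetric]) (simp add: carr)
  also have "\<dots> = {cyc_class n (g * f) | g. True}"
    unfolding cgenideal_def carr mult[symmetric] by blast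
  finally show ?thesis by (auto simp: cyc_class_eq_iff)
qed

lemma code_of_cyc_ideal_iff:
  "c \<in> code_of_ideal n (cyc_ideal n f) \<longleftrightarrow>
     c \<in> carrier_vec n \<and> (\<exists>g. cyc_poly n dvd word_poly n (vec_index c) - g * f)"
  by (simp add: code_of_ideal_def cyc_class_in_cyc_ideal_iff word_poly_def)

text \<open>Self-adjointness moves d from the codeword to v. Shifts of d pick out the single
  coefficients of v d; conversely every codeword is a convolution of some w with d, and its product
  with v is that of w with v d.\<close>

lemma orthogonal_cyclic_code_iff:
  fixes v :: "'r::comm_ring_1 vec"
  assumes n: "n > 0" and sym: "reversible n d"
    and v: "v \<in> carrier_vec n"
  shows "(\<forall>c\<in>code_of_ideal n (cyc_ideal n (word_poly n d)). v \<bullet> c = 0) \<longleftrightarrow>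
    cyc_poly n dvd word_poly n (vec_index v) * word_poly n d"
proof
  have sp: "v \<bullet> c = (\<Sum>k<n. v $ k * c $ k)" if "c \<in> carrier_vec n" for c
    using that v by (simp add: scalar_prod_def atLeast0LessThan)
  {
    assume orth: "\<forall>c\<in>code_of_ideal n (cyc_ideal n (word_poly n d)). v \<bullet> c = 0"
    have "cyc_conv n (vec_index v) d i = 0" if i: "i < n" for i
    proof -
      \<comment> \<open>\<delta> represents x^i, so that c is the i-th cyclic shift of d.\<close>
      define \<delta> :: "nat \<Rightarrow> 'r" where "\<delta> j = (if j = i then 1 else 0)" for j
      define c where "c = vec n (cyc_conv n \<delta> d)"
      have "word_poly n (vec_index c) = word_poly n (cyc_conv n \<delta> d)"
        by (rule word_poly_cong) (simp add: c_def)
      then have "cyc_poly n dvd word_poly n (vec_index c) - word_poly n \<delta> * word_poly n d"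
        using dvd_minus_iff[THEN iffD2, OF word_poly_mult[of n \<delta> d]] by simp
      then have "c \<in> code_of_ideal n (cyc_ideal n (word_poly n d))"
        by (auto simp: code_of_cyc_ideal_iff c_def)
      then have "0 = v \<bullet> c" using orth by simp
      also have "\<dots> = (\<Sum>k<n. v $ k * cyc_conv n \<delta> d k)"
        by (subst sp) (auto simp: c_def)
      also have "\<dots> = (\<Sum>j<n. \<delta> j * cyc_conv n (vec_index v) d j)"
        by (rule sum_mult_cyc_conv[OF sym])
      also have "\<dots> = (\<Sum>j<n. if j = i then cyc_conv n (vec_index v) d j else 0)"
        by (intro sum.cong) (auto simp: \<delta>_def)
      also have "\<dots> = cyc_conv n (vec_index v) d i" using i by simp
      finally show ?thesis by simp
    qed
    then show "cyc_poly n dvd word_poly n (vec_index v) * word_poly n d"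
      by (simp add: dvd_word_poly_mult_iff[OF n])
  }
  {
    assume "cyc_poly n dvd word_poly n (vec_index v) * word_poly n d"
    then have zero: "\<forall>k<n. cyc_conv n (vec_index v) d k = 0"
      by (simp add: dvd_word_poly_mult_iff[OF n])
    show "\<forall>c\<in>code_of_ideal n (cyc_ideal n (word_poly n d)). v \<bullet> c = 0"
    proof
      fix c assume c: "c \<in> code_of_ideal n (cyc_ideal n (word_poly n d))"
      then obtain g where cn: "c \<in> carrier_vec n"
        and g: "cyc_poly n dvd word_poly n (vec_index c) - g * word_poly n d"
        by (auto simp: code_of_cyc_ideal_iff)
      \<comment> \<open>Replacing the multiplier g by a word w makes c congruent to the convolution
        of w and d, hence equal to it entry by entry.\<close>
      obtain w where w: "cyc_poly n dvd g - word_poly n w"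
        using ex_word_poly_cong[OF n] by blast
      have "word_poly n (\<lambda>i. c $ i - cyc_conv n w d i)
          = (word_poly n (vec_index c) - g * word_poly n d) + (g - word_poly n w) * word_poly n d
            + (word_poly n w * word_poly n d - word_poly n (cyc_conv n w d))"
        by (simp add: word_poly_diff algebra_simps)
      also have "cyc_poly n dvd \<dots>"
        using g w word_poly_mult[of n w d] by (intro dvd_add dvd_mult2) auto
      finally have "c $ i = cyc_conv n w d i" if "i < n" for i
        using that by (simp add: word_poly_dvd_iff[OF n])
      then have "v \<bullet> c = (\<Sum>k<n. v $ k * cyc_conv n w d k)"
        by (simp add: sp[OF cn])
      also have "\<dots> = (\<Sum>i<n. w i * cyc_conv n (vec_index v) d i)"
        by (rule sum_mult_cyc_conv[OF sym])
      also have "\<dots> = 0" using zero by simp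
      finally show "v \<bullet> c = 0" .
    qed
  }
qed

section \<open>Duals of bordered cyclic codes\<close>

context vec_module
begin

lemma orthogonal_complement_submodule:
  assumes "W \<subseteq> carrier_vec n"
  shows "LinearCombinations.submodule class_ring (orthogonal_complement W) V"
proof (rule LinearCombinations.submodule.intro)
  show "Module.module (class_ring :: 'a ring) V" by (rule module_axioms)
qed (use assms in \<open>auto simp: orthogonal_complement_def module_vec_simps subset_iff
  add_scalar_prod_distrib[of _ n]\<close>)

text \<open>S lies in its double complement, which is a submodule and so contains the span of
  S.\<close>

lemma orthogonal_complement_span:
  assumes S: "S \<subseteq> carrier_vec n"
  shows "orthogonal_complement (span S) = orthogonal_complement S"
proof
  show "orthogonal_complement (span S) \<subseteq> orthogonal_complement S"
    by (rule orthogonal_complement_subset[OF in_own_span[OF S]])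
  have oc: "orthogonal_complement W \<subseteq> carrier_vec n" for W
    by (auto simp: orthogonal_complement_def)
  have "S \<subseteq> orthogonal_complement (orthogonal_complement S)"
    using S by (auto simp: orthogonal_complement_def comm_scalar_prod[of _ n] subset_iff)
  then have "span S \<subseteq> orthogonal_complement (orthogonal_complement S)"
    by (rule span_is_subset) (rule orthogonal_complement_submodule[OF oc])
  then have "x \<bullet> y = 0" if "x \<in> orthogonal_complement S" "y \<in> span S" for x y
    using that comm_scalar_prod[of x n y] by (auto simp: orthogonal_complement_def)
  then show "orthogonal_complement S \<subseteq> orthogonal_complement (span S)"
    by (auto simp: orthogonal_complement_def)
qed

lemma add_smult_mem_span:
  assumes "S \<subseteq> carrier_vec n" and "x \<in> S" and "y \<in> S"
  shows "x + a \<cdot>\<^sub>v y \<in> span S"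
proof -
  interpret sub: LinearCombinations.submodule class_ring "span S" V
    by (rule span_is_submodule[OF assms(1)])
  have "x \<in> span S" "y \<in> span S" using in_own_span[OF assms(1)] assms by auto
  then show ?thesis
    using sub.m_closed[of x "a \<cdot>\<^sub>v y"] sub.smult_closed[of a y] by (simp add: module_vec_simps)
qed

end

text \<open>Only generators of an extended code; the code itself is their span. Orthogonality to the
  span can be tested on them.\<close>

definition bordered_code :: "nat \<Rightarrow> 'r::comm_ring_1 \<Rightarrow> (nat \<Rightarrow> 'r) \<Rightarrow> 'r vec set" where
  "bordered_code n r d =
     vCons 0 ` code_of_ideal n (cyc_ideal n (word_poly n d)) \<union> {vCons r (vec n (\<lambda>_. 1))}"

lemma bordered_code_carrier: "bordered_code n r d \<subseteq> carrier_vec (Suc n)"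
  by (auto simp: bordered_code_def code_of_ideal_def)

text \<open>Generators with entry 0 at \<infinity> test only v and give the divisibility; the border
  vector gives the linear equation.\<close>

lemma orthogonal_bordered_code_iff:
  fixes v :: "'r::comm_ring_1 vec"
  assumes n: "n > 0" and sym: "reversible n d"
    and v: "v \<in> carrier_vec n"
  shows "vCons a v \<in> vec_module.orthogonal_complement (Suc n) (bordered_code n r d) \<longleftrightarrow>
    cyc_poly n dvd word_poly n (vec_index v) * word_poly n d \<and> a * r + (\<Sum>i<n. v $ i) = 0"
proof -
  have "v \<bullet> vec n (\<lambda>_. 1) = (\<Sum>i<n. v $ i)"
    by (simp add: scalar_prod_def atLeast0LessThan)
  then show ?thesis
    using v orthogonal_cyclic_code_iff[OF n sym v]
    by (auto simp: vec_module.orthogonal_complement_def bordered_code_def)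
qed

text \<open>Let f, f' and h be the word polynomials of d, d' and the all-one word; \<nu> is 1/n.
  Multiplying f + f' + \<nu> h = 1 by v splits a dual word into a multiple of f' and a multiple of
  h. The relation r r' = -n matches the entries at \<infinity>.\<close>

lemma dual_bordered_code:
  fixes d d' :: "nat \<Rightarrow> 'r::comm_ring_1"
  assumes n: "n > 0"
    and sym: "reversible n d"
    and inv: "of_nat n * \<nu> = (1 :: 'r)"
    and zero: "poly (word_poly n d) 1 = 0" "poly (word_poly n d') 1 = 0"
    and prod: "cyc_poly n dvd word_poly n d * word_poly n d'"
    and sum: "word_poly n d + word_poly n d' + Polynomial.smult \<nu> (word_poly n (\<lambda>_. 1)) = 1"
    and r: "r * r' = - of_nat n"
    and r1: "r = 1 \<or> r' = 1"
  shows "vec_module.orthogonal_complement (Suc n)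
       (LinearCombinations.module.span class_ring (module_vec TYPE('r) (Suc n)) (bordered_code n r d))
     = LinearCombinations.module.span class_ring (module_vec TYPE('r) (Suc n)) (bordered_code n r' d')"
proof -
  interpret vec_module "TYPE('r)" "Suc n" .
  let ?M = "cyc_poly n :: 'r poly" and ?f = "word_poly n d" and ?f' = "word_poly n d'"
  let ?h = "word_poly n (\<lambda>_. 1 :: 'r)"
  note orth_iff = orthogonal_bordered_code_iff[OF n sym]
  \<comment> \<open>An inverse of r, used to solve for a: if r' = 1 then r = -n, whose inverse is
    -\<nu>.\<close>
  obtain s :: 'r where s: "s * r = 1"
  proof (cases "r = 1")
    case False
    then have "- \<nu> * r = 1" using r r1 inv by (simp add: mult.commute)
    then show ?thesis using that by blast
  qed (use that[of 1] in simp)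
  have h_f: "?M dvd ?h * ?f"
    using ones_mult[of n ?f] zero by simp
  have "orthogonal_complement (bordered_code n r d) = span (bordered_code n r' d')"
  proof
    show "orthogonal_complement (bordered_code n r d) \<subseteq> span (bordered_code n r' d')"
    proof
      fix x assume x: "x \<in> orthogonal_complement (bordered_code n r d)"
      then have "x \<in> carrier_vec (Suc n)" unfolding orthogonal_complement_def by simp
      then obtain a v where xav: "x = vCons a v" and v: "v \<in> carrier_vec n"
        by (cases x) auto
      let ?v = "word_poly n (vec_index v)" and ?t = "\<nu> * (\<Sum>i<n. v $ i)"
      from x have vf: "?M dvd ?v * ?f" and a: "a * r + (\<Sum>i<n. v $ i) = 0"
        by (simp_all add: xav orth_iff[OF v])
      \<comment> \<open>Subtracting the all-one component \<open>?t\<close> leaves v f', because v f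
        = 0 and h v = v(1) h modulo x^n - 1.\<close>
      define c where "c = v - ?t \<cdot>\<^sub>v vec n (\<lambda>_. 1)"
      have c: "c \<in> carrier_vec n" using v by (simp add: c_def)
      have "word_poly n (vec_index c) = word_poly n (\<lambda>i. v $ i - ?t * 1)"
        by (rule word_poly_cong) (use v in \<open>simp add: c_def\<close>)
      also have "\<dots> = ?v - Polynomial.smult ?t ?h"
        by (simp only: word_poly_diff word_poly_smult)
      finally have "word_poly n (vec_index c) - ?v * ?f'
        = ?v * (?f + ?f' + Polynomial.smult \<nu> ?h) - Polynomial.smult ?t ?h - ?v * ?f'"
        using sum by simp
      also have "\<dots> = ?v * ?f + Polynomial.smult \<nu> (?h * ?v - Polynomial.smult (poly ?v 1) ?h)"
        by (simp add: poly_word_poly_1 algebra_simps smult_diff_right)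
      also have "?M dvd \<dots>"
        using vf ones_mult[of n ?v] by (intro dvd_add dvd_smult)
      finally have "c \<in> code_of_ideal n (cyc_ideal n ?f')"
        using c by (auto simp: code_of_cyc_ideal_iff)
      then have mem: "vCons 0 c \<in> bordered_code n r' d'" "vCons r' (vec n (\<lambda>_. 1)) \<in> bordered_code n r' d'"
        by (auto simp: bordered_code_def)
      \<comment> \<open>a r = -v(1) = -n \<open>?t\<close> = \<open>?t\<close> r r', and s cancels
        r.\<close>
      have "a = ?t * r'"
      proof -
        have "a = (a * r) * s" using s by (simp add: mult.assoc mult.commute[of r s])
        also have "a * r = - (\<Sum>i<n. v $ i)" using a by (simp add: eq_neg_iff_add_eq_0)
        also have "\<dots> = - (of_nat n * \<nu> * (\<Sum>i<n. v $ i))" using inv by simp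
        also have "\<dots> = ?t * (r * r')" by (simp add: r algebra_simps)
        also have "\<dots> * s = ?t * r' * (s * r)" by (simp add: algebra_simps)
        finally show ?thesis using s by simp
      qed
      then have "x = vCons 0 c + ?t \<cdot>\<^sub>v vCons r' (vec n (\<lambda>_. 1))"
        using v by (auto simp: xav c_def vec_eq_iff vec_index_vCons)
      then show "x \<in> span (bordered_code n r' d')"
        using add_smult_mem_span[OF bordered_code_carrier mem] by simp
    qed
    \<comment> \<open>The complement is a submodule, so the reverse inclusion is tested on
      generators.\<close>
    have "bordered_code n r' d' \<subseteq> orthogonal_complement (bordered_code n r d)"
    proof
      fix x assume "x \<in> bordered_code n r' d'"
      then consider c where "x = vCons 0 c" "c \<in> code_of_ideal n (cyc_ideal n ?f')"
        | "x = vCons r' (vec n (\<lambda>_. 1))"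
        by (auto simp: bordered_code_def)
      then show "x \<in> orthogonal_complement (bordered_code n r d)"
      proof cases
        case 1
        then obtain g where c: "c \<in> carrier_vec n" and g: "?M dvd word_poly n (vec_index c) - g * ?f'"
          by (auto simp: code_of_cyc_ideal_iff)
        have "word_poly n (vec_index c) * ?f = (word_poly n (vec_index c) - g * ?f') * ?f + g * (?f * ?f')"
          by (simp add: algebra_simps)
        also have "?M dvd \<dots>" by (rule dvd_add[OF dvd_mult2[OF g] dvd_mult[OF prod]])
        finally have "?M dvd word_poly n (vec_index c) * ?f" .
        \<comment> \<open>The coordinate sum is the value at 1, where f' and x^n - 1 both
          vanish.\<close>
        moreover have "(\<Sum>i<n. c $ i) = 0"
        proof -
          obtain k where "word_poly n (vec_index c) - g * ?f' = ?M * k" using g ..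
          then have "poly (word_poly n (vec_index c) - g * ?f') 1 = poly (?M * k) 1" by simp
          then show ?thesis using zero by (simp add: poly_word_poly_1 poly_monom)
        qed
        ultimately show ?thesis using 1 by (simp add: orth_iff[OF c])
      next
        \<comment> \<open>The all-one word satisfies h f = f(1) h = 0 modulo x^n - 1, and r' r + n =
          0.\<close>
        case 2
        have "word_poly n (vec_index (vec n (\<lambda>_. 1))) = ?h"
          by (rule word_poly_cong) simp
        then show ?thesis
          using h_f r by (simp add: 2 orth_iff mult.commute)
      qed
    qed
    then show "span (bordered_code n r' d') \<subseteq> orthogonal_complement (bordered_code n r d)"
      by (rule span_is_subset) (rule orthogonal_complement_submodule[OF bordered_code_carrier])
  qed
  then show ?thesis by (simp add: orthogonal_complement_span[OF bordered_code_carrier])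
qed

section \<open>The quadratic Gauss sum\<close>

lemma sum_lessThan_int:
  fixes f :: "int \<Rightarrow> 'b::comm_monoid_add"
  shows "(\<Sum>i<n. f (int i)) = (\<Sum>i\<in>{0..<int n}. f i)"
  by (rule sum.reindex_bij_betw) (auto simp: bij_betw_def image_int_atLeastLessThan lessThan_atLeast0)

text \<open>The polynomial J, whose values at q-th roots of unity are Gauss sums.\<close>

abbreviation Legendre_poly :: "nat \<Rightarrow> 'r::comm_ring_1 poly" where
  "Legendre_poly q \<equiv> word_poly q (\<lambda>i. of_int (Legendre (int i) (int q)))"

text \<open>By \<open>sum_Legendre_convolution\<close> the coefficients of J^2 modulo x^q - 1 are q
  - 1 at 0 and -1 elsewhere, which are those of q - h.\<close>

lemma Legendre_poly_square:
  assumes "prime q" and "[q = 1] (mod 4)"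
  shows "cyc_poly q dvd Legendre_poly q * Legendre_poly q
           - ([:of_nat q:] - word_poly q (\<lambda>_. 1 :: 'r::comm_ring_1))"
proof -
  let ?\<chi> = "\<lambda>i. Legendre (int i) (int q)"
  have q: "q > 0" using assms(1) by (simp add: prime_gt_0_nat)
  have "cyc_conv q (\<lambda>i. of_int (?\<chi> i)) (\<lambda>i. of_int (?\<chi> i)) k
      = of_nat q * (if k = 0 then 1 else 0) - (1 :: 'r)" if k: "k < q" for k
  proof -
    have shift: "?\<chi> ((k + q - i) mod q) = Legendre (int k - int i) (int q)" if "i < q" for i
    proof -
      have "int ((k + q - i) mod q) = (int k - int i) mod int q"
        using that by (simp add: of_nat_mod of_nat_diff)
          (metis add.commute add_diff_eq mod_add_self1)
      then show ?thesis by (simp add: Legendre_mod)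
    qed
    have "cyc_conv q (\<lambda>i. of_int (?\<chi> i)) (\<lambda>i. of_int (?\<chi> i)) k
        = (of_int (\<Sum>i<q. Legendre (int i) (int q) * Legendre (int k - int i) (int q)) :: 'r)"
      by (simp add: cyc_conv_def shift)
    also have "(\<Sum>i<q. Legendre (int i) (int q) * Legendre (int k - int i) (int q))
        = (if k = 0 then int q else 0) - 1"
      using sum_Legendre_convolution[OF assms, of "int k"] k
      by (simp add: sum_lessThan_int[of "\<lambda>i. Legendre i (int q) * Legendre (int k - i) (int q)"])
    finally show ?thesis by simp
  qed
  then have "word_poly q (cyc_conv q (\<lambda>i. of_int (?\<chi> i)) (\<lambda>i. of_int (?\<chi> i)))
      = word_poly q (\<lambda>k. of_nat q * (if k = 0 then 1 else 0) - (1 :: 'r))"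
    by (rule word_poly_cong)
  also have "\<dots> = [:of_nat q:] - word_poly q (\<lambda>_. 1)"
    by (simp only: word_poly_diff word_poly_smult word_poly_delta[OF q] smult_one)
  finally show ?thesis
    using word_poly_mult[of q "\<lambda>i. of_int (?\<chi> i) :: 'r" "\<lambda>i. of_int (?\<chi> i)"] by simp
qed

lemma sum_powers_root_of_unity:
  fixes \<alpha> :: "'a::idom"
  assumes "\<alpha> ^ n = 1" and "\<alpha> \<noteq> 1"
  shows "(\<Sum>i<n. \<alpha> ^ i) = 0"
  using power_diff_1_eq[of \<alpha> n] assms by simp

text \<open>Evaluate J^2 = q - h at \<alpha>: both x^q - 1 and h vanish there.\<close>

lemma Gauss_sum_square:
  fixes \<alpha> :: "'a::idom"
  assumes "prime q" and "[q = 1] (mod 4)" and "\<alpha> ^ q = 1" and "\<alpha> \<noteq> 1"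
  shows "(\<Sum>i=1..q-1. of_int (Legendre (int i) (int q)) * \<alpha> ^ i)\<^sup>2 = of_nat q"
proof -
  have "poly (Legendre_poly q) \<alpha> = (\<Sum>i<q. of_int (Legendre (int i) (int q)) * \<alpha> ^ i)"
    by (simp add: word_poly_def poly_sum poly_monom)
  also have "\<dots> = (\<Sum>i=1..q-1. of_int (Legendre (int i) (int q)) * \<alpha> ^ i)"
  proof (rule sum.mono_neutral_right)
    show "\<forall>i\<in>{..<q} - {1..q-1}. of_int (Legendre (int i) (int q)) * \<alpha> ^ i = 0"
    proof
      fix i assume "i \<in> {..<q} - {1..q-1}"
      then have "i = 0" by auto
      then show "of_int (Legendre (int i) (int q)) * \<alpha> ^ i = 0" by (simp add: Legendre_def)
    qed
  qed (use prime_gt_0_nat[OF assms(1)] in auto)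
  finally have J: "poly (Legendre_poly q) \<alpha> = \<dots>" .
  obtain k where "Legendre_poly q * Legendre_poly q - ([:of_nat q:] - word_poly q (\<lambda>_. 1))
      = (cyc_poly q :: 'a poly) * k"
    using Legendre_poly_square[OF assms(1,2)] ..
  then have "poly (Legendre_poly q * Legendre_poly q - ([:of_nat q:] - word_poly q (\<lambda>_. 1))) \<alpha>
      = poly (cyc_poly q * k) \<alpha>"
    by simp
  then have "(poly (Legendre_poly q) \<alpha>)\<^sup>2 = of_nat q - (\<Sum>i<q. \<alpha> ^ i)"
    using assms(3) by (simp add: poly_monom power2_eq_square) (simp add: word_poly_def poly_sum poly_monom)
  then show ?thesis
    using sum_powers_root_of_unity[OF assms(3,4)] J by simp
qed

lemma primitive_root_of_unity_neq_1:
  "primitive_root_of_unity n z \<Longrightarrow> 1 < n \<Longrightarrow> z \<noteq> 1"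
  by (force simp: primitive_root_of_unity_def)

text \<open>
  By quadratic reciprocity \<open>q\<close> has a square root in the prime field, so the Gauss sum, whose square
  is \<open>q\<close>, lies in the image of \<^const>\<open>to_ac\<close> and \<^const>\<open>of_ac\<close> does not return a junk value.
\<close>

lemma gauss_theta_square:
  fixes \<alpha> :: "'p::prime_card mod_ring alg_closure"
  assumes "prime p" and "CARD('p) = p" and "2 < p"
    and "prime q" and "[q = 1] (mod 4)"
    and "Legendre (int p) (int q) = 1"
    and "primitive_root_of_unity q \<alpha>"
  shows "gauss_theta q \<alpha> * gauss_theta q \<alpha> = of_nat q"
proof -
  have q2: "2 < q" using assms by (intro cong_1_mod_4_imp_gt_2)
  have "p \<noteq> q" using assms(6) by (auto simp: Legendre_def cong_def)
  then have "Legendre (int p) (int q) * Legendre (int q) (int p) = (-1) ^ ((p - 1) div 2 * ((q - 1) div 2))"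
    using assms q2 by (intro Quadratic_Reciprocity) auto
  \<comment> \<open>This makes the sign in the reciprocity law equal to 1.\<close>
  moreover have "even ((q - 1) div 2)"
    using assms(5) unfolding cong_def by presburger
  ultimately have "Legendre (int q) (int p) = 1" using assms(6) by simp
  then have "QuadRes (int p) (int q)" by (auto simp: Legendre_def split: if_splits)
  then obtain y where "[y\<^sup>2 = int q] (mod int p)" by (auto simp: QuadRes_def)
  then have "(of_int (y\<^sup>2) :: 'p mod_ring) = of_int (int q)"
    using assms(2) by (simp only: of_int_eq_iff_cong_CHAR semiring_char_mod_ring)
  define t :: "'p mod_ring" where "t = of_int y"
  have t: "t * t = of_nat q"
    using \<open>of_int (y\<^sup>2) = of_int (int q)\<close> by (simp add: t_def power2_eq_square)
  let ?\<theta> = "\<Sum>i=1..q-1. of_int (Legendre (int i) (int q)) * \<alpha> ^ i"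
  have "?\<theta>\<^sup>2 = of_nat q"
    using assms q2 primitive_root_of_unity_neq_1[OF assms(7)]
    by (intro Gauss_sum_square) (auto simp: primitive_root_of_unity_def)
  also have "\<dots> = (to_ac t)\<^sup>2"
    by (simp add: power2_eq_square t flip: to_ac_mult)
  \<comment> \<open>Elements of a field with equal squares agree up to sign, and both signs lie in
    the image of \<open>to_ac\<close>.\<close>
  finally have "?\<theta> = to_ac t \<or> ?\<theta> = to_ac (- t)"
    by (simp add: power2_eq_iff)
  then have "gauss_theta q \<alpha> = t \<or> gauss_theta q \<alpha> = - t"
    unfolding gauss_theta_def by (elim disjE) (simp_all only: of_ac_to_ac simp_thms)
  then show ?thesis using t by auto
qed

section \<open>Quadratic residue codes\<close>

text \<open>The coefficients of 1/2 (1 - h/q - s J); s = 1/\<theta> gives \<open>e1\<close> and s =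
  -1/\<theta> gives \<open>e2\<close>. The factor 1 lets \<open>word_poly_smult\<close> see a
  multiple of the all-one word.\<close>

definition qr_word :: "nat \<Rightarrow> 'a::field \<Rightarrow> nat \<Rightarrow> 'a" where
  "qr_word q s i = 1/2 * ((if i = 0 then 1 else 0) - 1 / of_nat q * 1 - s * of_int (Legendre (int i) (int q)))"

lemma word_poly_qr_word:
  assumes "q > 0"
  shows "word_poly q (qr_word q s)
    = Polynomial.smult (1/2) (1 - Polynomial.smult (1 / of_nat q) (word_poly q (\<lambda>_. 1))
                              - Polynomial.smult s (Legendre_poly q))"
  unfolding qr_word_def
  by (simp only: word_poly_diff word_poly_smult word_poly_delta[OF assms])

text \<open>Coefficients are compared at 0, at residues and at nonresidues, where \<chi> is 0, 1 and
  -1.\<close>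

lemma e1_e2_eq_word_poly:
  fixes \<alpha> :: "'p::prime_card mod_ring alg_closure"
  assumes "q > 0"
  shows "e1 q \<alpha> = word_poly q (qr_word q (1 / gauss_theta q \<alpha>))"
    and "e2 q \<alpha> = word_poly q (qr_word q (- (1 / gauss_theta q \<alpha>)))"
proof -
  have j: "poly.coeff (j1 q :: 'p mod_ring poly) i = (if i \<in> quad_residues q then 1 else 0)"
    "poly.coeff (j2 q :: 'p mod_ring poly) i = (if i \<in> quad_nonresidues q then 1 else 0)" for i
    by (simp_all add: j1_def j2_def coeff_sum quad_residues_def quad_nonresidues_def)
  have const: "poly.coeff [:a:] i = (if i = 0 then a else 0)" for a :: "'p mod_ring" and i
    by (cases i) auto
  have mem: "i \<in> quad_residues q \<longleftrightarrow> 0 < i \<and> i < q \<and> Legendre (int i) (int q) = 1"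
    "i \<in> quad_nonresidues q \<longleftrightarrow> 0 < i \<and> i < q \<and> Legendre (int i) (int q) \<noteq> 1" for i
    by (auto simp: quad_residues_def quad_nonresidues_def Legendre_def cong_0_iff dest: zdvd_imp_le)
  have val: "Legendre (int i) (int q) = -1" if "0 < i" "i < q" "Legendre (int i) (int q) \<noteq> 1" for i
    using that by (auto simp: Legendre_def cong_0_iff split: if_splits dest: dvd_imp_le)
  show "e1 q \<alpha> = word_poly q (qr_word q (1 / gauss_theta q \<alpha>))"
    by (rule poly_eqI, use assms in \<open>auto simp: val e1_def j mem coeff_word_poly qr_word_def const
        Legendre_def[of 0] algebra_simps\<close>)
  show "e2 q \<alpha> = word_poly q (qr_word q (- (1 / gauss_theta q \<alpha>)))"
    by (rule poly_eqI, use assms in \<open>auto simp: val e2_def j mem coeff_word_poly qr_word_def const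
        Legendre_def[of 0] algebra_simps\<close>)
qed

text \<open>\<chi>(-i) = \<chi>(i), because \<chi>(-1) = 1 for q = 1 modulo 4.\<close>

lemma reversible_qr_word:
  assumes "prime q" and "[q = 1] (mod 4)"
  shows "reversible q (qr_word q s)"
proof -
  have "qr_word q s ((q - i) mod q) = qr_word q s i" if i: "i < q" for i
  proof (cases "i = 0")
    case False
    then have "int ((q - i) mod q) = (- 1 * int i) mod int q"
      using i by (simp add: of_nat_mod of_nat_diff zmod_zminus1_eq_if)
    then have "Legendre (int ((q - i) mod q)) (int q) = Legendre (-1 * int i) (int q)"
      by (simp only: Legendre_mod)
    also have "\<dots> = Legendre (int i) (int q)"
      using Legendre_mult[OF assms(1) cong_1_mod_4_imp_gt_2[OF assms], of "-1" "int i"]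
      by (simp add: Legendre_minus_one[OF assms])
    finally show ?thesis using False i by (simp add: qr_word_def)
  qed simp
  then show ?thesis by (simp add: reversible_def)
qed

text \<open>h(1) = q cancels the 1, and J(1) = 0 is the vanishing character sum.\<close>

lemma poly_qr_word_1:
  assumes "prime q" and "2 < q" and "(of_nat q :: 'a::field) \<noteq> 0"
  shows "poly (word_poly q (qr_word q (s :: 'a))) 1 = 0"
proof -
  have "(\<Sum>i<q. of_int (Legendre (int i) (int q))) = (of_int (\<Sum>i<q. Legendre (int i) (int q)) :: 'a)"
    by simp
  also have "\<dots> = 0"
    by (simp only: sum_lessThan_int[of "\<lambda>i. Legendre i (int q)"] sum_Legendre[OF assms(1,2)] of_int_0)
  finally show ?thesis
    using assms by (simp add: word_poly_qr_word poly_word_poly_1)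
qed

lemma qr_word_add:
  assumes "q > 0" and "(2 :: 'a::field) \<noteq> 0"
  shows "word_poly q (qr_word q s) + word_poly q (qr_word q (- s))
    + Polynomial.smult (1 / of_nat q) (word_poly q (\<lambda>_. 1)) = (1 :: 'a poly)"
proof -
  define h :: "'a poly" where "h = word_poly q (\<lambda>_. 1)"
  have half: "Polynomial.smult (1/2) f + Polynomial.smult (1/2) f = f" for f :: "'a poly"
    using assms(2) by (simp flip: smult_add_left)
  have "word_poly q (qr_word q s) + word_poly q (qr_word q (- s))
      = Polynomial.smult (1/2) (1 - Polynomial.smult (1 / of_nat q) h)
        + Polynomial.smult (1/2) (1 - Polynomial.smult (1 / of_nat q) h)"
    using assms(1) by (simp add: word_poly_qr_word h_def smult_diff_right smult_add_right)
  also have "\<dots> = 1 - Polynomial.smult (1 / of_nat q) h" by (rule half)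
  finally show ?thesis by (simp add: h_def)
qed

text \<open>The product is a quarter of (1 - h/q)^2 - s^2 J^2. With h^2 = q h, J^2 = q - h and s^2 =
  1/q, both squares become 1 - h/q.\<close>

lemma qr_word_mult:
  assumes "prime q" and "[q = 1] (mod 4)" and "(of_nat q :: 'a::field) \<noteq> 0"
    and s: "s * s = 1 / of_nat q"
  shows "cyc_poly q dvd word_poly q (qr_word q s) * word_poly q (qr_word q (- s :: 'a))"
proof -
  define A Q S h J :: "'a poly" where "A = [:1 / of_nat q:]" and "Q = [:of_nat q:]" and "S = [:s:]"
    and "h = word_poly q (\<lambda>_. 1)" and "J = Legendre_poly q"
  have AQ: "A * Q = 1" and SA: "S * S = A"
    using assms(3) s by (simp_all add: A_def Q_def S_def one_pCons)
  have h: "cyc_poly q dvd h * h - Q * h"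
    using ones_mult[of q h] by (simp add: h_def Q_def poly_word_poly_1)
  have J: "cyc_poly q dvd J * J - (Q - h)"
    unfolding J_def Q_def h_def by (rule Legendre_poly_square[OF assms(1,2)])
  have "(1 - A * h - S * J) * (1 - A * h + S * J) = A * A * (h * h - Q * h) - A * (J * J - (Q - h))"
  proof -
    have "(1 - A * h - S * J) * (1 - A * h + S * J)
        = 1 - A * h - A * h + A * A * (h * h) - S * S * (J * J)"
      by (simp add: algebra_simps)
    \<comment> \<open>Factors A Q = 1 are inserted so that h^2 - Q h and J^2 - (Q - h) can be split
      off.\<close>
    also have "\<dots> = A * A * (h * h) - (A * Q) * (A * h) - A * (J * J) + A * Q - A * h"
      by (simp add: AQ SA)
    also have "\<dots> = A * A * (h * h - Q * h) - A * (J * J - (Q - h))"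
      by (simp add: algebra_simps)
    finally show ?thesis .
  qed
  also have "cyc_poly q dvd \<dots>"
    by (rule dvd_diff[OF dvd_mult[OF h] dvd_mult[OF J]])
  finally have "cyc_poly q dvd (1 - A * h - S * J) * (1 - A * h + S * J)" .
  moreover have "word_poly q (qr_word q s) * word_poly q (qr_word q (- s))
      = Polynomial.smult (1/4) ((1 - A * h - S * J) * (1 - A * h + S * J))"
    using prime_gt_0_nat[OF assms(1)]
    by (simp add: word_poly_qr_word A_def S_def h_def J_def)
  ultimately show ?thesis by (simp add: dvd_smult)
qed

section \<open>Extension of scalars from the field to R\<close>

interpretation u_const: comm_ring_hom "u_const :: 'a::comm_ring_1 \<Rightarrow> 'a u_ring"
  by unfold_locales (transfer; simp add: one_pCons)+

interpretation u_const_poly: map_poly_comm_ring_hom "u_const :: 'a::comm_ring_1 \<Rightarrow> 'a u_ring" ..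

lemma map_word_poly: "map_poly u_const (word_poly q c) = word_poly q (\<lambda>i. u_const (c i))"
  by (rule poly_eqI) (simp add: coeff_word_poly coeff_map_poly)

text \<open>The coefficients of \<open>f\<^sub>\<eta>\<close>, when s = 1/\<theta>.\<close>

definition qr_u_word :: "nat \<Rightarrow> 'a::field \<Rightarrow> 'a u_ring \<Rightarrow> nat \<Rightarrow> 'a u_ring" where
  "qr_u_word q s \<eta> i = (1 - \<eta>) * u_const (qr_word q s i) + \<eta> * u_const (qr_word q (- s) i)"

lemma word_poly_qr_u_word:
  "word_poly q (qr_u_word q s \<eta>) =
    Polynomial.smult (1 - \<eta>) (map_poly u_const (word_poly q (qr_word q s)))
    + Polynomial.smult \<eta> (map_poly u_const (word_poly q (qr_word q (- s))))"
  unfolding qr_u_word_def by (simp only: word_poly_add word_poly_smult map_word_poly)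

lemma map_u_const_dvd:
  assumes "cyc_poly q dvd (f :: 'a::comm_ring_1 poly)"
  shows "cyc_poly q dvd map_poly u_const f"
proof -
  from assms obtain k where "f = cyc_poly q * k" ..
  then have "map_poly u_const f = cyc_poly q * map_poly u_const k"
    by (simp add: u_const_poly.hom_mult u_const_poly.hom_minus map_poly_monom)
  then show ?thesis by simp
qed

text \<open>An instance of \<open>dual_bordered_code\<close> with r = 1 and r' = -q. The identities
  for the two field words are carried over by \<open>u_const\<close>, and idempotency of \<eta>
  gives the product condition.\<close>

lemma dual_qr_u_word:
  fixes s :: "'a::field"
  assumes "prime q" and "[q = 1] (mod 4)" and q0: "(of_nat q :: 'a) \<noteq> 0" and "(2 :: 'a) \<noteq> 0"
    and s: "s * s = 1 / of_nat q" and \<eta>: "\<eta> * \<eta> = (\<eta> :: 'a u_ring)"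
  shows "vec_module.orthogonal_complement (Suc q)
       (LinearCombinations.module.span class_ring (module_vec TYPE('a u_ring) (Suc q))
         (bordered_code q 1 (qr_u_word q s \<eta>)))
     = LinearCombinations.module.span class_ring (module_vec TYPE('a u_ring) (Suc q))
         (bordered_code q (- of_nat q) (qr_u_word q s (1 - \<eta>)))"
proof (rule dual_bordered_code[where \<nu> = "u_const (1 / of_nat q)"])
  have q2: "2 < q" using assms(1,2) by (rule cong_1_mod_4_imp_gt_2)
  then show "q > 0" by simp
  define E where "E t = map_poly u_const (word_poly q (qr_word q (t :: 'a)))" for t
  have word: "word_poly q (qr_u_word q s \<epsilon>) = Polynomial.smult (1 - \<epsilon>) (E s) + Polynomial.smult \<epsilon> (E (- s))" for \<epsilon>
    by (simp add: word_poly_qr_u_word E_def)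
  show "reversible q (qr_u_word q s \<eta>)"
    using reversible_qr_word[OF assms(1,2), of s] reversible_qr_word[OF assms(1,2), of "- s"]
    by (simp add: reversible_def qr_u_word_def)
  have "of_nat q * u_const (1 / of_nat q) = u_const (of_nat q * (1 / of_nat q :: 'a))"
    by (simp only: u_const.hom_mult u_const.hom_of_nat)
  then show "of_nat q * u_const (1 / of_nat q :: 'a) = 1"
    using q0 by simp
  have "poly (E t) 1 = 0" for t
    using u_const.poly_map_poly[of "word_poly q (qr_word q t)" 1] poly_qr_word_1[OF assms(1) q2 q0, of t]
    by (simp add: E_def)
  then show "poly (word_poly q (qr_u_word q s \<eta>)) 1 = 0"
    "poly (word_poly q (qr_u_word q s (1 - \<eta>))) 1 = 0"
    by (simp_all add: word)
  have E: "cyc_poly q dvd E s * E (- s)"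
    using map_u_const_dvd[OF qr_word_mult[OF assms(1,2) q0 s]] by (simp add: E_def u_const_poly.hom_mult)
  \<comment> \<open>The bracket is the square of E s - E (- s); its factor \<eta> - \<eta>^2
    vanishes.\<close>
  have "word_poly q (qr_u_word q s \<eta>) * word_poly q (qr_u_word q s (1 - \<eta>))
      = E s * E (- s) + Polynomial.smult (\<eta> - \<eta> * \<eta>) (E s * E s + E (- s) * E (- s) - 2 * (E s * E (- s)))"
    unfolding word by (simp add: algebra_simps smult_diff_left smult_add_left smult_diff_right smult_add_right)
  then show "cyc_poly q dvd word_poly q (qr_u_word q s \<eta>) * word_poly q (qr_u_word q s (1 - \<eta>))"
    using E by (simp add: \<eta>)
  have "map_poly u_const (word_poly q (qr_word q s) + word_poly q (qr_word q (- s))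
      + Polynomial.smult (1 / of_nat q) (word_poly q (\<lambda>_. 1))) = 1"
    using qr_word_add[of q s] assms(4) q2 by simp
  then have "E s + E (- s) + Polynomial.smult (u_const (1 / of_nat q)) (word_poly q (\<lambda>_. 1)) = 1"
    by (simp add: E_def u_const_poly.hom_add u_const.map_poly_hom_smult map_word_poly)
  moreover have "word_poly q (qr_u_word q s \<eta>) + word_poly q (qr_u_word q s (1 - \<eta>)) = E s + E (- s)"
    unfolding word by (simp add: algebra_simps smult_diff_left)
  ultimately show "word_poly q (qr_u_word q s \<eta>) + word_poly q (qr_u_word q s (1 - \<eta>))
      + Polynomial.smult (u_const (1 / of_nat q)) (word_poly q (\<lambda>_. 1)) = 1"
    by simp
qed simp_all

section \<open>Idempotents of R\<close>

text \<open>Since w^4 = w, multiplication by w permutes the summands of w + w^2 + w^3. This sum s is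
  thus fixed by every power of w used, so s^2 = 3 s and (1 - w^3) s = 0.\<close>

lemma power_sum_idempotent:
  fixes c w :: "'r::comm_ring_1"
  assumes "w ^ 4 = w" and "3 * c = 1"
  shows "c * (w + w ^ 2 + w ^ 3) * (c * (w + w ^ 2 + w ^ 3)) = c * (w + w ^ 2 + w ^ 3)"
    and "(1 - w ^ 3) * (c * (w + w ^ 2 + w ^ 3)) = 0"
proof -
  define s where "s = w + w ^ 2 + w ^ 3"
  have 1: "w * s = s"
    using assms(1) by (simp add: s_def algebra_simps eval_nat_numeral)
  then have 2: "w ^ 2 * s = s" and 3: "w ^ 3 * s = s"
    by (simp_all only: power2_eq_square power3_eq_cube mult.assoc)
  have "s * s = w * s + w ^ 2 * s + w ^ 3 * s"
    by (subst s_def) (simp only: distrib_right)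
  also have "\<dots> = 3 * s" by (simp only: 1 2 3) simp
  finally have ss: "s * s = 3 * s" .
  have "c * s * (c * s) = c * c * (s * s)" by (simp only: ac_simps)
  also have "\<dots> = (3 * c) * (c * s)" by (simp only: ss ac_simps)
  finally show "c * (w + w ^ 2 + w ^ 3) * (c * (w + w ^ 2 + w ^ 3)) = c * (w + w ^ 2 + w ^ 3)"
    by (simp only: assms mult_1_left s_def)
  have "(1 - w ^ 3) * (c * s) = c * (s - w ^ 3 * s)"
    by (simp add: algebra_simps)
  then show "(1 - w ^ 3) * (c * (w + w ^ 2 + w ^ 3)) = 0"
    by (simp add: 3 flip: s_def)
qed

text \<open>Apart from \<open>eta \<xi> 1\<close>, each value of \<open>eta\<close> is a power sum
  in w = z u with z a cube root of unity. Then w^4 = w, and w^3 = u^3 links it to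
  \<open>eta \<xi> 1\<close>.\<close>

lemma eta_idempotent:
  fixes \<xi> :: "'p::prime_card mod_ring"
  assumes "(3 :: 'p mod_ring) \<noteq> 0" and "\<xi> ^ 3 = 1" 
  shows "eta \<xi> i * eta \<xi> i = eta \<xi> i" and "i \<noteq> 1 \<Longrightarrow> eta \<xi> 1 * eta \<xi> i = 0"
proof -
  let ?u = "u_gen :: 'p mod_ring u_ring" and ?c = "u_const (inverse 3 :: 'p mod_ring)"
  \<comment> \<open>The last branch also covers all indices on which \<open>eta\<close> takes its
    default form; there z^2 = \<xi>^4 = \<xi>.\<close>
  define z where "z = (if i = 2 then 1 else if i = 3 then \<xi> else \<xi> ^ 2)"
  let ?w = "u_const z * ?u"
  have \<xi>4: "\<xi> ^ 4 = \<xi>" using power_add[of \<xi> 3 1] assms(2) by simp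
  have \<xi>6: "\<xi> ^ 6 = 1" using power_mult[of \<xi> 3 2] assms(2) by simp
  have "z ^ 3 = 1" using assms(2) \<xi>6 by (simp add: z_def flip: power_mult)
  then have z: "u_const z ^ 3 = 1"
    using u_const.hom_power[of z 3] by simp
  then have "u_const z ^ 4 = u_const z"
    using power_add[of "u_const z" 3 1] by simp
  then have w: "?w ^ 4 = ?w"
    by (simp add: power_mult_distrib u_gen_power4)
  have w3: "?w ^ 3 = ?u ^ 3" by (simp add: power_mult_distrib z)
  have "3 * ?c = u_const (3 * inverse 3)"
    by (simp only: u_const.hom_mult u_const.hom_numeral)
  then have c: "3 * ?c = 1" using assms(1) by simp
  have \<eta>: "eta \<xi> i = ?c * (?w + ?w ^ 2 + ?w ^ 3)" if "i \<noteq> 1"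
  proof -
    have "u_const z ^ 2 = u_const (z ^ 2)" by (simp only: u_const.hom_power)
    then show ?thesis
      using that unfolding power_mult_distrib z mult_1_left
      by (simp add: eta_def z_def \<xi>4 flip: power_mult)
  qed
  have u6: "?u ^ 3 * ?u ^ 3 = ?u ^ 3"
  proof -
    have "?u ^ 3 * ?u ^ 3 = ?u ^ 4 * ?u ^ 2" by (simp flip: power_add)
    also have "\<dots> = ?u ^ 3"
      unfolding u_gen_power4 by (simp add: power2_eq_square power3_eq_cube)
    finally show ?thesis .
  qed
  have \<eta>1: "eta \<xi> 1 = 1 - ?u ^ 3" by (simp add: eta_def)
  show "eta \<xi> i * eta \<xi> i = eta \<xi> i"
  proof (cases "i = 1")
    case True
    then show ?thesis unfolding \<eta>1 True using u6 by (simp add: algebra_simps)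
  next
    case False
    show ?thesis unfolding \<eta>[OF False] by (rule power_sum_idempotent(1)[OF w c])
  qed
  show "eta \<xi> 1 * eta \<xi> i = 0" if "i \<noteq> 1"
    using power_sum_idempotent(2)[OF w c] unfolding \<eta>1 \<eta>[OF that] w3 .
qed

section \<open>Assembly of the fourteen codes\<close>

text \<open>The \<eta> for which generator k is \<open>f\<^sub>\<eta>\<close>, that is, its
  coefficient at \<open>e2\<close>. Generators 9 to 11 carry the sum of two idempotents at
  \<open>e1\<close>, hence the complement here.\<close>

definition qr_idempotent :: "'p::prime_card mod_ring \<Rightarrow> nat \<Rightarrow> 'p mod_ring u_ring" where
  "qr_idempotent \<xi> k =
    (if k \<in> {1..4} then eta \<xi> k
     else if k \<in> {5..8} then 1 - eta \<xi> (k - 4)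
     else if k \<in> {9..11} then 1 - (eta \<xi> 1 + eta \<xi> (k - 7))
     else eta \<xi> 1 + eta \<xi> (k - 10))"

lemma extended_qr_code_eq:
  fixes \<alpha> :: "'p::prime_card mod_ring alg_closure"
  assumes "q > 0"
  shows "extended_qr_code q \<alpha> \<xi> k =
    LinearCombinations.module.span class_ring (module_vec TYPE('p mod_ring u_ring) (Suc q))
      (bordered_code q (border q k) (qr_u_word q (1 / gauss_theta q \<alpha>) (qr_idempotent \<xi> k)))"
proof -
  have "qr_generator q \<alpha> \<xi> k = word_poly q (qr_u_word q (1 / gauss_theta q \<alpha>) (qr_idempotent \<xi> k))"
    unfolding word_poly_qr_u_word e1_e2_eq_word_poly[OF assms, symmetric]
    by (simp add: qr_generator_def qr_idempotent_def Let_def diff_diff_eq add.commute)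
  then show ?thesis
    by (simp add: extended_qr_code_def bordered_code_def qr_ideal_def)
qed

theorem theorem12:
  fixes p q :: nat
    and \<xi> :: "'p::prime_card mod_ring"
    and \<alpha> :: "'p mod_ring alg_closure"
  assumes "prime p" and "CARD('p) = p" and "[p = 1] (mod 3)"
    and "prime q" and "[q = 1] (mod 4)"
    and "Legendre (int p) (int q) = 1"
    and "primitive_root_of_unity 3 \<xi>"
    and "primitive_root_of_unity q \<alpha>"
  shows "(\<forall>i\<in>{1, 2, 3, 4}. euclidean_dual (q + 1) (extended_qr_code q \<alpha> \<xi> i)
            = extended_qr_code q \<alpha> \<xi> (i + 4)) \<and>
         (\<forall>i\<in>{9, 10, 11}. euclidean_dual (q + 1) (extended_qr_code q \<alpha> \<xi> i)
            = extended_qr_code q \<alpha> \<xi> (i + 3))"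
proof -
  \<comment> \<open>The congruence modulo 3 excludes 2 and 3, so both are invertible in the prime
    field.\<close>
  have p: "p \<noteq> 2" "p \<noteq> 3" using assms(3) by (auto simp: cong_def)
  have p2: "2 < p" using p prime_ge_2_nat[OF assms(1)] by simp
  have nz: "(of_nat r :: 'p mod_ring) \<noteq> 0" if "prime r" "r \<noteq> p" for r
    using that assms(1,2) primes_dvd_imp_eq of_nat_0_mod_ring_dvd[of r, where 'a = 'p] by metis
  have 2: "(2 :: 'p mod_ring) \<noteq> 0" using nz[of 2] p by simp
  have 3: "(3 :: 'p mod_ring) \<noteq> 0" using nz[of 3] p by simp
  have "p \<noteq> q" using assms(6) by (auto simp: Legendre_def cong_def)
  then have q: "(of_nat q :: 'p mod_ring) \<noteq> 0" using nz[OF assms(4)] by simp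
  have q0: "q > 0" using assms(4) by (rule prime_gt_0_nat)
  let ?s = "1 / gauss_theta q \<alpha>"
  have s: "?s * ?s = 1 / of_nat q"
    using gauss_theta_square[OF assms(1,2) p2 assms(4-6,8)] by simp
  have xi: "\<xi> ^ 3 = 1" using assms(7) by (simp add: primitive_root_of_unity_def)
  note idem = eta_idempotent[OF 3 xi]
  \<comment> \<open>All seven dualities reduce to complementary idempotents with the matching border
    entries.\<close>
  have dual: "euclidean_dual (q + 1) (extended_qr_code q \<alpha> \<xi> i) = extended_qr_code q \<alpha> \<xi> j"
    if "qr_idempotent \<xi> i * qr_idempotent \<xi> i = qr_idempotent \<xi> i"
      "qr_idempotent \<xi> j = 1 - qr_idempotent \<xi> i"
      "border q i = (1 :: 'p mod_ring u_ring)" "border q j = (- of_nat q :: 'p mod_ring u_ring)" for i j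
    using dual_qr_u_word[OF assms(4,5) q 2 s that(1)]
    unfolding extended_qr_code_eq[OF q0] that(2-) by simp
  \<comment> \<open>The sum of two orthogonal idempotents is idempotent, and so is its
    complement.\<close>
  have sum_idem: "(1 - (eta \<xi> 1 + eta \<xi> j)) * (1 - (eta \<xi> 1 + eta \<xi> j)) = 1 - (eta \<xi> 1 + eta \<xi> j)"
    if "j \<noteq> 1" for j
  proof -
    have "(1 - (eta \<xi> 1 + eta \<xi> j)) * (1 - (eta \<xi> 1 + eta \<xi> j))
      = 1 - (eta \<xi> 1 + eta \<xi> j) - (eta \<xi> 1 + eta \<xi> j)
        + (eta \<xi> 1 * eta \<xi> 1 + eta \<xi> j * eta \<xi> j + 2 * (eta \<xi> 1 * eta \<xi> j))"
      by (simp add: algebra_simps)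
    then show ?thesis by (simp only: idem(1) idem(2)[OF that]) simp
  qed
  show ?thesis
  proof (intro conjI ballI)
    fix i :: nat assume i: "i \<in> {1, 2, 3, 4}"
    then have "i \<in> {1..4}" "i + 4 \<in> {5..8}" "i + 4 \<notin> {1..4}" by auto
    then show "euclidean_dual (q + 1) (extended_qr_code q \<alpha> \<xi> i) = extended_qr_code q \<alpha> \<xi> (i + 4)"
      using i by (intro dual) (auto simp: qr_idempotent_def idem border_def)
  next
    fix i :: nat assume i: "i \<in> {9, 10, 11}"
    then have "qr_idempotent \<xi> i = 1 - (eta \<xi> 1 + eta \<xi> (i - 7))"
      "qr_idempotent \<xi> (i + 3) = eta \<xi> 1 + eta \<xi> (i - 7)"
      by (auto simp: qr_idempotent_def)
    then show "euclidean_dual (q + 1) (extended_qr_code q \<alpha> \<xi> i) = extended_qr_code q \<alpha> \<xi> (i + 3)"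
      using i sum_idem[of "i - 7"] by (intro dual) (auto simp: border_def)
  qed
qed

end
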